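(* Consider the $n$-missile system $$V_{r,i}=\dot r_i,\quad V_{q,i}=\dot\lambda_i r_i,\quad \dot V_{r,i}=\frac{V_{q,i}^2}{r_i}-u_i^r+u_{T,i}^r,\quad \dot V_{q,i}=-\frac{V_{q,i}V_{r,i}}{r_i}-u_i^q+u_{T,i}^q\qquad(i=1,\dots,n),$$ with the guidance law $$u_i^q=-\frac{V_{q,i}V_{r,i}}{r_i}+k_3V_{q,i}^{m_3/n_3}+k_4V_{q,i}^{p_3/q_3}+\varepsilon|V_{q,i}|^{\omega}\operatorname{sign}(V_{q,i})\qquad(i=1,\dots,n).$$ Then $V_{q,i}=0$ for all $i=1,\dots,n$ is achieved in fixed time: for every initial condition there is a settling time $T_3$ with $V_{q,i}(t)=0$ for all $t\ge T_3$ and all $i$, and $$T_3\le \frac{n^{(m_3-n_3)/(2n_3)}}{k_3}\,\frac{n_3}{m_3-n_3}+\frac{1}{k_4}\,\frac{q_3}{q_3-p_3}.$$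
   Context: There are $n$ missiles attacking one target in a plane. For missile $i$: $r_i$ is the distance to the target, $\lambda_i$ the line-of-sight (LOS) angle, $V_{r,i}$ and $V_{q,i}$ the velocity components along and perpendicular to the LOS, $u_i^r,u_i^q$ the missile's acceleration components along and perpendicular to the LOS, and $u_{T,i}^r,u_{T,i}^q$ the target's corresponding acceleration components. All of these are functions of time $t\ge 0$. Parameters: $k_3,k_4>0$; $\varepsilon>0$; $0<\omega<1$; $m_3,n_3,p_3,q_3$ positive odd integers with $m_3/n_3>1$ and $p_3/q_3<1$. Powers with exponent a ratio of odd integers are real odd powers, i.e. $x^{m/n}=\operatorname{sgn}(x)|x|^{m/n}$. "Fixed time" means that the settling time is bounded by a constant independent of the initial conditions.
   Formalization: Added hypothesis: sign(V_{q,i}) u_{T,i}^q ≤ ε|V_{q,i}|^ω for all t ≥ 0 and all i. Without it the claim fails: r=1, λ=t, V_r=0, V_q=1, u^r=1, u_T^r=0, u_T^q=k_3+k_4+ε solves the system and V_q never vanishes. *)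

theory Defs
  imports "HOL-Analysis.Analysis"
begin

text \<open>Signed real power. For odd positive integers \<open>m\<close>, \<open>n\<close>, the real odd power
  \<open>x\<^sup>m\<^sup>/\<^sup>n\<close> is \<open>spow x (m / n)\<close>. Since \<open>0 powr a = 0\<close>, it vanishes at \<open>x = 0\<close>.\<close>

definition spow :: "real \<Rightarrow> real \<Rightarrow> real" where
  "spow x a = sgn x * \<bar>x\<bar> powr a"

text \<open>Trajectories are indexed by the missile \<open>i \<in> {1..n}\<close> and by time; they are classical
  solutions on \<open>t \<ge> 0\<close>, with one-sided derivatives at \<open>t = 0\<close>. The distances stay positive,
  so no division by zero occurs.\<close>

definition missile_system ::
  "nat \<Rightarrow> (nat \<Rightarrow> real \<Rightarrow> real) \<Rightarrow> (nat \<Rightarrow> real \<Rightarrow> real) \<Rightarrow> (nat \<Rightarrow> real \<Rightarrow> real) \<Rightarrow> (nat \<Rightarrow> real \<Rightarrow> real)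
    \<Rightarrow> (nat \<Rightarrow> real \<Rightarrow> real) \<Rightarrow> (nat \<Rightarrow> real \<Rightarrow> real) \<Rightarrow> (nat \<Rightarrow> real \<Rightarrow> real) \<Rightarrow> (nat \<Rightarrow> real \<Rightarrow> real) \<Rightarrow> bool"
  where
  "missile_system n r lam Vr Vq ur uq uTr uTq \<longleftrightarrow>
     (\<forall>i\<in>{1..n}. \<forall>t\<ge>0.
        r i t > 0 \<and>
        (r i has_real_derivative Vr i t) (at t within {0..}) \<and>
        (\<exists>lam'. (lam i has_real_derivative lam') (at t within {0..}) \<and> Vq i t = lam' * r i t) \<and>
        (Vr i has_real_derivative (Vq i t)\<^sup>2 / r i t - ur i t + uTr i t) (at t within {0..}) \<and>
        (Vq i has_real_derivative - (Vq i t * Vr i t) / r i t - uq i t + uTq i t) (at t within {0..}))"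

definition guidance_law ::
  "real \<Rightarrow> real \<Rightarrow> real \<Rightarrow> real \<Rightarrow> nat \<Rightarrow> nat \<Rightarrow> nat \<Rightarrow> nat
    \<Rightarrow> nat \<Rightarrow> (nat \<Rightarrow> real \<Rightarrow> real) \<Rightarrow> (nat \<Rightarrow> real \<Rightarrow> real) \<Rightarrow> (nat \<Rightarrow> real \<Rightarrow> real) \<Rightarrow> (nat \<Rightarrow> real \<Rightarrow> real) \<Rightarrow> bool"
  where
  "guidance_law k3 k4 \<epsilon> \<omega> m3 n3 p3 q3 n r Vr Vq uq \<longleftrightarrow>
     (\<forall>i\<in>{1..n}. \<forall>t\<ge>0.
        uq i t = - (Vq i t * Vr i t) / r i t
               + k3 * spow (Vq i t) (real m3 / real n3)
               + k4 * spow (Vq i t) (real p3 / real q3)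
               + \<epsilon> * \<bar>Vq i t\<bar> powr \<omega> * sgn (Vq i t))"

text \<open>The guidance law does not cancel the target's lateral acceleration \<open>uTq\<close>, so a restriction
  on \<open>uTq\<close> is needed: with \<open>uTq\<close> constant equal to \<open>k3 + k4 + \<epsilon>\<close>, for instance, \<open>Vq\<close> can stay at
  \<open>1\<close> forever. The predicate below says that the component of \<open>uTq\<close> driving \<open>Vq\<close> away from \<open>0\<close>
  is at most the robust term of the law, i.e. \<open>Vq * uTq \<le> \<epsilon> * \<bar>Vq\<bar> powr (1 + \<omega>)\<close>. It holds for a
  non-maneuvering target and whenever \<open>\<bar>uTq\<bar> \<le> \<epsilon> * \<bar>Vq\<bar> powr \<omega>\<close>.\<close>

definition maneuver_dominated ::
  "real \<Rightarrow> real \<Rightarrow> nat \<Rightarrow> (nat \<Rightarrow> real \<Rightarrow> real) \<Rightarrow> (nat \<Rightarrow> real \<Rightarrow> real) \<Rightarrow> bool"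
  where
  "maneuver_dominated \<epsilon> \<omega> n Vq uTq \<longleftrightarrow>
     (\<forall>i\<in>{1..n}. \<forall>t\<ge>0. sgn (Vq i t) * uTq i t \<le> \<epsilon> * \<bar>Vq i t\<bar> powr \<omega>)"

end

theory Submission
  imports Defs
begin

text \<open>
  Substituting the law into the dynamics cancels the coupling term \<open>Vq * Vr / r\<close>, so the
  lateral velocities decouple: along each trajectory
  \<open>Vq' = - k3 * spow Vq a - k4 * spow Vq b - \<epsilon> * \<bar>Vq\<bar> powr \<omega> * sgn Vq + uTq\<close>
  with \<open>a = m3 / n3 > 1 > b = p3 / q3\<close>, and the robust term absorbs \<open>uTq\<close>. The energy
  \<open>y = Vq\<^sup>2\<close> of a single missile therefore satisfies
  \<open>y' \<le> - 2 * k3 * y powr ((a + 1) / 2) - 2 * k4 * y powr ((b + 1) / 2)\<close>.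

  Such an inequality forces extinction in a time independent of \<open>y 0\<close>
  (lemma \<open>fixed_time_extinction\<close>). The superlinear term alone brings \<open>y\<close> from any height
  down to \<open>1\<close> within \<open>1 / (k3 * (a - 1))\<close>, because \<open>\<integral> dy / y powr p\<close> converges at infinity
  for \<open>p > 1\<close>; the sublinear term alone brings \<open>y\<close> from \<open>1\<close> to \<open>0\<close> within
  \<open>1 / (k4 * (1 - b))\<close>, because that integral converges at \<open>0\<close> for \<open>p < 1\<close>.
  Both integrals are handled by \<open>power_law_decay\<close>.

  Working with every missile separately, instead of with the total energy \<open>\<Sum>i. (Vq i)\<^sup>2\<close>,
  gives the bound with the constant \<open>1\<close> in the place of
  \<open>n powr ((m3 - n3) / (2 * n3))\<close>, which is at least \<open>1\<close>. That power of \<open>n\<close> is what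
  the comparison of power means costs when the total energy is used.
\<close>

lemma derivative_le_imp_increment_le:
  fixes f f' :: "real \<Rightarrow> real"
  assumes "s \<le> t"
    and deriv: "\<And>x. x \<in> {s..t} \<Longrightarrow> (f has_real_derivative f' x) (at x within {s..t})"
    and bound: "\<And>x. x \<in> {s..t} \<Longrightarrow> f' x \<le> C"
  shows "f t - f s \<le> C * (t - s)"
proof -
  obtain x where "x \<in> {s..t}" "f t - f s = f' x * (t - s)"
    using mvt_very_simple[OF \<open>s \<le> t\<close>, of f "\<lambda>x. (*) (f' x)"] deriv
    by (auto simp: has_field_derivative_def)
  then show ?thesis
    using bound[of x] \<open>s \<le> t\<close> by (simp add: mult_right_mono)
qed

text \<open>Separation of variables: \<open>y powr (1 - p) / (1 - p)\<close> is an antiderivative of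
  \<open>1 / y powr p\<close>, so along \<open>y\<close> it decreases at rate at least \<open>c\<close>. Keeping the division by
  \<open>1 - p\<close> covers both signs of \<open>1 - p\<close>.\<close>

lemma power_law_decay:
  fixes y y' :: "real \<Rightarrow> real"
  assumes "s \<le> t" and "p \<noteq> 1"
    and deriv: "\<And>x. x \<in> {s..t} \<Longrightarrow> (y has_real_derivative y' x) (at x within {s..t})"
    and pos: "\<And>x. x \<in> {s..t} \<Longrightarrow> y x > 0"
    and rate: "\<And>x. x \<in> {s..t} \<Longrightarrow> y' x \<le> - c * y x powr p"
  shows "y t powr (1 - p) / (1 - p) \<le> y s powr (1 - p) / (1 - p) - c * (t - s)"
proof -
  have "((\<lambda>x. y x powr (1 - p) / (1 - p)) has_real_derivative y x powr (- p) * y' x)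
          (at x within {s..t})" if "x \<in> {s..t}" for x
    using deriv[OF that] pos[OF that] \<open>p \<noteq> 1\<close>
    by (auto intro!: derivative_eq_intros)
  moreover have "y x powr (- p) * y' x \<le> - c" if "x \<in> {s..t}" for x
  proof -
    have "y x powr (- p) * y' x \<le> y x powr (- p) * (- c * y x powr p)"
      using rate[OF that] by (intro mult_left_mono) auto
    also have "\<dots> = - c"
      using pos[OF that] by (simp add: powr_minus)
    finally show ?thesis .
  qed
  ultimately have "y t powr (1 - p) / (1 - p) - y s powr (1 - p) / (1 - p) \<le> - c * (t - s)"
    by (rule derivative_le_imp_increment_le[OF \<open>s \<le> t\<close>])
  then show ?thesis by simp
qed

text \<open>The motion is split into two phases where \<open>y\<close> crosses \<open>1\<close>. At this threshold
  \<open>y powr (1 - p)\<close> and \<open>y powr (1 - q)\<close> are both \<open>1\<close>, so the time of each phase depends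
  on its own term only: on \<open>A\<close> and \<open>p\<close> above \<open>1\<close>, on \<open>B\<close> and \<open>q\<close> below.\<close>

lemma fixed_time_extinction:
  fixes y y' :: "real \<Rightarrow> real"
  assumes "A > 0" and "B > 0" and "p > 1" and "q < 1"
    and nonneg: "\<And>t. t \<ge> 0 \<Longrightarrow> y t \<ge> 0"
    and deriv: "\<And>t. t \<ge> 0 \<Longrightarrow> (y has_real_derivative y' t) (at t within {0..})"
    and decay: "\<And>t. t \<ge> 0 \<Longrightarrow> y' t \<le> - (A * y t powr p) - B * y t powr q"
    and late: "t \<ge> 1 / (A * (p - 1)) + 1 / (B * (1 - q))"
  shows "y t = 0"
proof (rule ccontr)
  define s where "s = 1 / (A * (p - 1))"
  have "s \<ge> 0" and "s \<le> t" and phase2: "t - s \<ge> 1 / (B * (1 - q))"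
    using late assms(1-4) by (auto simp: s_def intro: order_trans[rotated])
  have deriv_on: "(y has_real_derivative y' x) (at x within {u..v})"
    if "0 \<le> u" "x \<in> {u..v}" for u v x
    using deriv[of x] that by (auto intro: DERIV_subset)
  have rate_p: "y' x \<le> - A * y x powr p" and rate_q: "y' x \<le> - B * y x powr q"
    if "x \<ge> 0" for x
  proof -
    have "0 \<le> A * y x powr p" "0 \<le> B * y x powr q"
      using \<open>A > 0\<close> \<open>B > 0\<close> by simp_all
    then show "y' x \<le> - A * y x powr p" "y' x \<le> - B * y x powr q"
      using decay[OF that] by linarith+
  qed
  have antimono: "y v \<le> y u" if "0 \<le> u" "u \<le> v" for u v
  proof -
    have "y' x \<le> 0" if "x \<in> {u..v}" for x
    proof -
      have "0 \<le> A * y x powr p"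
        using \<open>A > 0\<close> by simp
      then show ?thesis
        using rate_p[of x] that \<open>0 \<le> u\<close> by simp
    qed
    then have "y v - y u \<le> 0 * (v - u)"
      using deriv_on that by (intro derivative_le_imp_increment_le) auto
    then show ?thesis by simp
  qed
  assume "y t \<noteq> 0"
  then have "y t > 0"
    using nonneg[of t] \<open>s \<ge> 0\<close> \<open>s \<le> t\<close> by simp
  \<comment> \<open>By monotonicity \<open>y\<close> has not vanished before \<open>t\<close>, so separation of variables applies
    on all of \<open>{0..t}\<close>.\<close>
  have pos: "y x > 0" if "0 \<le> x" "x \<le> t" for x
    using antimono[OF that] \<open>y t > 0\<close> by simp
  have "y s < 1"
  proof (rule ccontr)
    assume "\<not> y s < 1"
    then have "y s powr (1 - p) \<le> 1"
      using \<open>p > 1\<close> powr_mono2'[of "1 - p" 1 "y s"] by simp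
    have "y s powr (1 - p) / (1 - p) \<le> y 0 powr (1 - p) / (1 - p) - A * (s - 0)"
      using deriv_on pos rate_p \<open>s \<ge> 0\<close> \<open>s \<le> t\<close> \<open>p > 1\<close> by (intro power_law_decay) auto
    then have "(1 - p) * (y 0 powr (1 - p) / (1 - p) - A * s)
        \<le> (1 - p) * (y s powr (1 - p) / (1 - p))"
      using \<open>p > 1\<close> by (intro mult_left_mono_neg) auto
    then have "y s powr (1 - p) \<ge> y 0 powr (1 - p) + A * (p - 1) * s"
      using \<open>p > 1\<close> by (simp add: right_diff_distrib) (simp add: algebra_simps)
    also have "A * (p - 1) * s = 1"
      using \<open>A > 0\<close> \<open>p > 1\<close> by (simp add: s_def)
    finally have "y s powr (1 - p) \<ge> y 0 powr (1 - p) + 1" .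
    moreover have "y 0 powr (1 - p) > 0"
      using pos[of 0] \<open>s \<ge> 0\<close> \<open>s \<le> t\<close> by simp
    ultimately show False
      using \<open>y s powr (1 - p) \<le> 1\<close> by simp
  qed
  have "y s powr (1 - q) \<le> 1"
    using \<open>y s < 1\<close> \<open>q < 1\<close> pos[of s] \<open>s \<ge> 0\<close> \<open>s \<le> t\<close> powr_mono2[of "1 - q" "y s" 1] by simp
  have "y t powr (1 - q) / (1 - q) \<le> y s powr (1 - q) / (1 - q) - B * (t - s)"
    using deriv_on pos rate_q \<open>s \<ge> 0\<close> \<open>s \<le> t\<close> \<open>q < 1\<close> by (intro power_law_decay) auto
  then have "(1 - q) * (y t powr (1 - q) / (1 - q))
      \<le> (1 - q) * (y s powr (1 - q) / (1 - q) - B * (t - s))"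
    using \<open>q < 1\<close> by (intro mult_left_mono) auto
  also have "\<dots> = (1 - q) * (y s powr (1 - q) / (1 - q)) - B * (1 - q) * (t - s)"
    by (simp add: right_diff_distrib[of "1 - q"] mult_ac)
  finally have "y t powr (1 - q) \<le> y s powr (1 - q) - B * (1 - q) * (t - s)"
    using \<open>q < 1\<close> by simp
  moreover have "B * (1 - q) * (t - s) \<ge> 1"
    using phase2 \<open>B > 0\<close> \<open>q < 1\<close> by (simp add: field_simps)
  moreover have "y t powr (1 - q) > 0"
    using \<open>y t > 0\<close> by simp
  ultimately show False
    using \<open>y s powr (1 - q) \<le> 1\<close> by simp
qed

lemma mult_spow_eq: "x * spow x a = (x\<^sup>2) powr ((a + 1) / 2)"
proof (cases "x = 0")
  case False
  have "x * spow x a = \<bar>x\<bar> * \<bar>x\<bar> powr a"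
    by (simp add: spow_def abs_sgn)
  also have "\<dots> = \<bar>x\<bar> powr (a + 1)"
    using False by (simp add: powr_add)
  also have "a + 1 = 2 * ((a + 1) / 2)"
    by simp
  also have "\<bar>x\<bar> powr \<dots> = (\<bar>x\<bar> powr 2) powr ((a + 1) / 2)"
    by (simp only: powr_powr)
  also have "\<bar>x\<bar> powr 2 = x\<^sup>2"
    using False by simp
  finally show ?thesis .
qed (simp add: spow_def)

text \<open>At \<open>v = 0\<close> the domination hypothesis leaves \<open>d\<close> unconstrained; multiplying by \<open>v\<close>
  makes this harmless, and it is the reason for using the energy \<open>v\<^sup>2\<close> rather than \<open>\<bar>v\<bar>\<close>.\<close>

lemma energy_rate_le:
  fixes v d k l \<epsilon> \<omega> a b :: real
  assumes "sgn v * d \<le> \<epsilon> * \<bar>v\<bar> powr \<omega>"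
  shows "2 * v * (- k * spow v a - l * spow v b - \<epsilon> * \<bar>v\<bar> powr \<omega> * sgn v + d)
    \<le> - (2 * k * (v\<^sup>2) powr ((a + 1) / 2)) - 2 * l * (v\<^sup>2) powr ((b + 1) / 2)"
proof -
  have abs_v: "v * sgn v = \<bar>v\<bar>"
    by (simp add: abs_sgn)
  have "v * d = \<bar>v\<bar> * (sgn v * d)"
    by (simp add: sgn_if)
  also have "\<dots> \<le> \<bar>v\<bar> * (\<epsilon> * \<bar>v\<bar> powr \<omega>)"
    using assms by (intro mult_left_mono) auto
  also have "\<dots> = v * (\<epsilon> * \<bar>v\<bar> powr \<omega> * sgn v)"
    by (simp flip: abs_v)
  finally show ?thesis
    unfolding mult_spow_eq[symmetric] by (simp add: algebra_simps)
qed

theorem theorem3: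
  fixes n m3 n3 p3 q3 :: nat
    and k3 k4 \<epsilon> \<omega> :: real
    and r lam Vr Vq ur uq uTr uTq :: "nat \<Rightarrow> real \<Rightarrow> real"
  assumes "n \<ge> 1"
    and "k3 > 0" and "k4 > 0" and "\<epsilon> > 0" and "0 < \<omega>" and "\<omega> < 1"
    and "odd m3" and "odd n3" and "odd p3" and "odd q3"
    and "real m3 / real n3 > 1" and "real p3 / real q3 < 1"
    and "missile_system n r lam Vr Vq ur uq uTr uTq"
    and "guidance_law k3 k4 \<epsilon> \<omega> m3 n3 p3 q3 n r Vr Vq uq"
    and "maneuver_dominated \<epsilon> \<omega> n Vq uTq"
  shows "\<exists>T3\<ge>0. (\<forall>t\<ge>T3. \<forall>i\<in>{1..n}. Vq i t = 0) \<and>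
           T3 \<le> real n powr ((real m3 - real n3) / (2 * real n3)) / k3
                  * (real n3 / (real m3 - real n3))
                + 1 / k4 * (real q3 / (real q3 - real p3))"
proof -
  define a where "a = real m3 / real n3"
  define b where "b = real p3 / real q3"
  define T where "T = 1 / (k3 * (a - 1)) + 1 / (k4 * (1 - b))"
  have "a > 1" "b < 1"
    using assms by (auto simp: a_def b_def)
  have "n3 > 0" "q3 > 0"
    using \<open>odd n3\<close> \<open>odd q3\<close> by (auto intro: odd_pos)
  have "m3 > n3" "q3 > p3"
    using \<open>a > 1\<close> \<open>b < 1\<close> \<open>n3 > 0\<close> \<open>q3 > 0\<close> by (auto simp: a_def b_def field_simps)

  have "Vq i t = 0" if i: "i \<in> {1..n}" and "t \<ge> T" for i t
  proof -
    define v' where "v' x = - k3 * spow (Vq i x) a - k4 * spow (Vq i x) b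
      - \<epsilon> * \<bar>Vq i x\<bar> powr \<omega> * sgn (Vq i x) + uTq i x" for x
    have closed_loop: "(Vq i has_real_derivative v' x) (at x within {0..})" if "x \<ge> 0" for x
    proof -
      have "(Vq i has_real_derivative - (Vq i x * Vr i x) / r i x - uq i x + uTq i x)
              (at x within {0..})"
        using \<open>missile_system n r lam Vr Vq ur uq uTr uTq\<close> i that
        unfolding missile_system_def by blast
      moreover have "uq i x = - (Vq i x * Vr i x) / r i x + k3 * spow (Vq i x) a
          + k4 * spow (Vq i x) b + \<epsilon> * \<bar>Vq i x\<bar> powr \<omega> * sgn (Vq i x)"
        using \<open>guidance_law k3 k4 \<epsilon> \<omega> m3 n3 p3 q3 n r Vr Vq uq\<close> i that
        unfolding guidance_law_def a_def b_def by blast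
      ultimately show ?thesis
        by (simp add: v'_def algebra_simps)
    qed
    have "(Vq i t)\<^sup>2 = 0"
    proof (rule fixed_time_extinction[where y = "\<lambda>x. (Vq i x)\<^sup>2" and y' = "\<lambda>x. 2 * Vq i x * v' x"
          and A = "2 * k3" and B = "2 * k4" and p = "(a + 1) / 2" and q = "(b + 1) / 2"])
      show "((\<lambda>x. (Vq i x)\<^sup>2) has_real_derivative 2 * Vq i x * v' x) (at x within {0..})"
        if "x \<ge> 0" for x
        using closed_loop[OF that] by (auto intro!: derivative_eq_intros)
      show "2 * Vq i x * v' x \<le> - (2 * k3 * ((Vq i x)\<^sup>2) powr ((a + 1) / 2))
          - 2 * k4 * ((Vq i x)\<^sup>2) powr ((b + 1) / 2)" if "x \<ge> 0" for x
        using \<open>maneuver_dominated \<epsilon> \<omega> n Vq uTq\<close> i that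
        unfolding v'_def maneuver_dominated_def by (intro energy_rate_le) auto
      have "2 * k3 * ((a + 1) / 2 - 1) = k3 * (a - 1)" "2 * k4 * (1 - (b + 1) / 2) = k4 * (1 - b)"
        by (simp_all add: field_simps)
      then show "1 / (2 * k3 * ((a + 1) / 2 - 1)) + 1 / (2 * k4 * (1 - (b + 1) / 2)) \<le> t"
        using \<open>t \<ge> T\<close> by (simp only: T_def)
    qed (use \<open>k3 > 0\<close> \<open>k4 > 0\<close> \<open>a > 1\<close> \<open>b < 1\<close> in auto)
    then show ?thesis by simp
  qed
  moreover have "T \<ge> 0"
    using \<open>k3 > 0\<close> \<open>k4 > 0\<close> \<open>a > 1\<close> \<open>b < 1\<close> by (simp add: T_def)
  moreover have "T \<le> real n powr ((real m3 - real n3) / (2 * real n3)) / k3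
                  * (real n3 / (real m3 - real n3))
                + 1 / k4 * (real q3 / (real q3 - real p3))"
  proof -
    have "a - 1 = (real m3 - real n3) / real n3" "1 - b = (real q3 - real p3) / real q3"
      using \<open>n3 > 0\<close> \<open>q3 > 0\<close> by (simp_all add: a_def b_def diff_divide_distrib)
    note exponent_gaps = this
    have "1 / (k3 * (a - 1)) = 1 / k3 * (real n3 / (real m3 - real n3))"
      by (simp add: exponent_gaps)
    also have "\<dots> \<le> real n powr ((real m3 - real n3) / (2 * real n3)) / k3
                  * (real n3 / (real m3 - real n3))"
      using \<open>n \<ge> 1\<close> \<open>k3 > 0\<close> \<open>m3 > n3\<close>
      by (intro mult_right_mono divide_right_mono ge_one_powr_ge_zero) auto
    finally show ?thesis
      by (simp add: T_def exponent_gaps(2))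
  qed
  ultimately show ?thesis by blast
qed

end
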